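(* For every $x\in\mathcal{R}$, $$\mathbb{E}_{(S_1,\dots,S_n)\sim r_{\text{greedy}}(x)}\Big[\sum_{i\in I}g_i(S_i)\Big]=F(\phi(x)).$$
   Context: Generalized assignment problem: bins $I=\{1,\dots,n\}$, items $J=\{1,\dots,m\}$, values $v_{ij}\ge0$, weights $w_{ij}\ge0$, capacities $C_i\ge0$. $\mathcal{F}_i=\{S\subseteq J:\sum_{j\in S}w_{ij}\le C_i\}$. $g_i(S)=\sum_{j\in S}v_{ij}$ if $S\in\mathcal{F}_i$, and $g_i(S)=0$ otherwise. $\mathcal{R}$ is the set of all $x=(x_{i,S})\in[0,1]^{I\times 2^J}$ with $x_{i,S}=0$ for $S\notin\mathcal{F}_i$ and $\sum_{S\in\mathcal{F}_i}x_{i,S}\le1$ for every $i\in I$. Define $\phi:\mathcal{R}\to[0,1]^{I\times J}$ by $\phi(x)_{ij}=\sum_{S: j\in S}x_{i,S}$. For each item $j$ let $\sigma_j$ be a permutation of $I$ such that $v_{\sigma_j(i),j}$ is non-increasing as $i$ runs from $1$ to $n$, with $v_{\sigma_j(n+1),j}=0$. Define $F:[0,1]^{I\times J}\to\mathbb{R}_{\ge0}$ by $$F(y)=\sum_{j=1}^m\sum_{i=1}^n\big(v_{\sigma_j(i),j}-v_{\sigma_j(i+1),j}\big)\Big(1-\exp\big(-\sum_{k=1}^i y_{\sigma_j(k),j}\big)\Big).$$ Greedy rounding $r_{\text{greedy}}(x)$: (1) Let $y=\phi(x)$ and $y'_{ij}=1-e^{-y_{ij}}$. Compute a point $x'\in\mathcal{R}$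 with $\phi(x')=y'$ by the following procedure: start with $x':=x$, $\delta:=\phi(x)-y'$; for each bin $i$ and each item $j$ in turn, while $\delta_{ij}>0$: choose arbitrarily $S\ni j$ with $x'_{i,S}>0$, put $t=\min(x'_{i,S},\delta_{ij})$, decrease $x'_{i,S}$ by $t$, increase $x'_{i,S\setminus\{j\}}$ by $t$ if $S\setminus\{j\}\ne\emptyset$, and decrease $\delta_{ij}$ by $t$. (2) Independently for each bin $i$, tentatively assign to $i$ the set $S$ with probability $x'_{i,S}$ (and the empty set with the remaining probability). If an item $j$ is tentatively assigned to more than one bin, it is kept only by a bin with maximum value $v_{ij}$ among those bins (ties broken arbitrarily). $S_i$ is the set finally held by bin $i$; the output is $(S_1,\dots,S_n)$. *)

theory Defs
  imports "HOL-Probability.Probability" "HOL-Combinatorics.Permutations"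
begin

text \<open>
  An instance of the generalized assignment problem has bins \<open>{1..n}\<close>, items \<open>{1..m}\<close>, values \<open>v i j\<close>,
  weights \<open>w i j\<close> and capacities \<open>C i\<close>.  Families indexed by bins, items and item sets are total
  functions, of which only the values at \<open>i \<in> {1..n}\<close>, \<open>j \<in> {1..m}\<close>, \<open>S \<subseteq> {1..m}\<close> are relevant.
\<close>

definition feasible :: "nat \<Rightarrow> (nat \<Rightarrow> nat \<Rightarrow> real) \<Rightarrow> (nat \<Rightarrow> real) \<Rightarrow> nat \<Rightarrow> nat set set" where
  "feasible m w C i = {S. S \<subseteq> {1..m} \<and> (\<Sum>j\<in>S. w i j) \<le> C i}"

definition bin_value ::
  "nat \<Rightarrow> (nat \<Rightarrow> nat \<Rightarrow> real) \<Rightarrow> (nat \<Rightarrow> nat \<Rightarrow> real) \<Rightarrow> (nat \<Rightarrow> real) \<Rightarrow> nat \<Rightarrow> nat set \<Rightarrow> real" where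
  "bin_value m v w C i S = (if S \<in> feasible m w C i then \<Sum>j\<in>S. v i j else 0)"

definition polytope_R ::
  "nat \<Rightarrow> nat \<Rightarrow> (nat \<Rightarrow> nat \<Rightarrow> real) \<Rightarrow> (nat \<Rightarrow> real) \<Rightarrow> (nat \<Rightarrow> nat set \<Rightarrow> real) set" where
  "polytope_R n m w C = {x. \<forall>i\<in>{1..n}.
     (\<forall>S\<in>Pow {1..m}. x i S \<in> {0..1}) \<and>
     (\<forall>S\<in>Pow {1..m}. S \<notin> feasible m w C i \<longrightarrow> x i S = 0) \<and>
     (\<Sum>S\<in>feasible m w C i. x i S) \<le> 1}"

definition phi :: "nat \<Rightarrow> (nat \<Rightarrow> nat set \<Rightarrow> real) \<Rightarrow> nat \<Rightarrow> nat \<Rightarrow> real" where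
  "phi m x i j = (\<Sum>S | S \<subseteq> {1..m} \<and> j \<in> S. x i S)"

definition value_order :: "nat \<Rightarrow> nat \<Rightarrow> (nat \<Rightarrow> nat \<Rightarrow> real) \<Rightarrow> (nat \<Rightarrow> nat \<Rightarrow> nat) \<Rightarrow> bool" where
  "value_order n m v \<sigma> \<longleftrightarrow> (\<forall>j\<in>{1..m}. \<sigma> j permutes {1..n} \<and>
     (\<forall>i\<in>{1..n}. \<forall>k\<in>{1..n}. i \<le> k \<longrightarrow> v (\<sigma> j k) j \<le> v (\<sigma> j i) j))"

text \<open>\<open>sorted_value n v \<sigma> j i\<close> is $v_{\sigma_j(i),j}$ with the convention $v_{\sigma_j(n+1),j} = 0$.\<close>

definition sorted_value ::
  "nat \<Rightarrow> (nat \<Rightarrow> nat \<Rightarrow> real) \<Rightarrow> (nat \<Rightarrow> nat \<Rightarrow> nat) \<Rightarrow> nat \<Rightarrow> nat \<Rightarrow> real" where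
  "sorted_value n v \<sigma> j i = (if i = n + 1 then 0 else v (\<sigma> j i) j)"

definition F_obj ::
  "nat \<Rightarrow> nat \<Rightarrow> (nat \<Rightarrow> nat \<Rightarrow> real) \<Rightarrow> (nat \<Rightarrow> nat \<Rightarrow> nat) \<Rightarrow> (nat \<Rightarrow> nat \<Rightarrow> real) \<Rightarrow> real" where
  "F_obj n m v \<sigma> y = (\<Sum>j=1..m. \<Sum>i=1..n.
     (sorted_value n v \<sigma> j i - sorted_value n v \<sigma> j (i + 1)) *
     (1 - exp (- (\<Sum>k=1..i. y (\<sigma> j k) j))))"

text \<open>
  The first step of greedy rounding.  The state consists of \<open>x'\<close> and \<open>\<delta>\<close>.  The procedure is
  nondeterministic (in the choice of \<open>S\<close> and in the order of visiting the pairs of a bin and an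
  item), so it is given as a big-step relation between initial and final states.
\<close>

type_synonym state = "(nat \<Rightarrow> nat set \<Rightarrow> real) \<times> (nat \<Rightarrow> nat \<Rightarrow> real)"

definition remove_item ::
  "nat \<Rightarrow> nat \<Rightarrow> nat set \<Rightarrow> real \<Rightarrow> (nat \<Rightarrow> nat set \<Rightarrow> real) \<Rightarrow> nat \<Rightarrow> nat set \<Rightarrow> real" where
  "remove_item i j S t x = (\<lambda>i' S'. x i' S'
     - (if i' = i \<and> S' = S then t else 0)
     + (if i' = i \<and> S' = S - {j} \<and> S - {j} \<noteq> {} then t else 0))"

definition decrease :: "nat \<Rightarrow> nat \<Rightarrow> real \<Rightarrow> (nat \<Rightarrow> nat \<Rightarrow> real) \<Rightarrow> nat \<Rightarrow> nat \<Rightarrow> real" where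
  "decrease i j t \<delta> = (\<lambda>i' j'. \<delta> i' j' - (if i' = i \<and> j' = j then t else 0))"

inductive reduce_pair :: "nat \<Rightarrow> nat \<Rightarrow> nat \<Rightarrow> state \<Rightarrow> state \<Rightarrow> bool" for m i j where
  stop: "\<not> \<delta> i j > 0 \<Longrightarrow> reduce_pair m i j (x, \<delta>) (x, \<delta>)"
| iterate: "\<lbrakk>\<delta> i j > 0; S \<subseteq> {1..m}; j \<in> S; x i S > 0; t = min (x i S) (\<delta> i j);
     reduce_pair m i j (remove_item i j S t x, decrease i j t \<delta>) s\<rbrakk>
     \<Longrightarrow> reduce_pair m i j (x, \<delta>) s"

inductive reduce_pairs :: "nat \<Rightarrow> (nat \<times> nat) list \<Rightarrow> state \<Rightarrow> state \<Rightarrow> bool" for m where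
  Nil: "reduce_pairs m [] s s"
| Cons: "\<lbrakk>reduce_pair m i j s s'; reduce_pairs m ps s' s''\<rbrakk>
     \<Longrightarrow> reduce_pairs m ((i, j) # ps) s s''"

definition reduced_point ::
  "nat \<Rightarrow> nat \<Rightarrow> (nat \<Rightarrow> nat set \<Rightarrow> real) \<Rightarrow> (nat \<Rightarrow> nat set \<Rightarrow> real) \<Rightarrow> bool" where
  "reduced_point n m x x' \<longleftrightarrow> (\<exists>ps \<delta>'. distinct ps \<and> set ps = {1..n} \<times> {1..m} \<and>
     reduce_pairs m ps (x, \<lambda>i j. phi m x i j - (1 - exp (- phi m x i j))) (x', \<delta>'))"

text \<open>
  The empty set receives all the probability not used by nonempty sets, so \<open>x' i {}\<close> is not read.
  The argument of \<open>embed_pmf\<close> is a probability mass function whenever \<open>x' \<in> polytope_R n m w C\<close> and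
  \<open>i \<in> {1..n}\<close>.
\<close>

definition tentative_bin :: "nat \<Rightarrow> (nat \<Rightarrow> nat set \<Rightarrow> real) \<Rightarrow> nat \<Rightarrow> nat set pmf" where
  "tentative_bin m x' i = embed_pmf (\<lambda>S.
     if S = {} then 1 - (\<Sum>S'\<in>Pow {1..m} - {{}}. x' i S')
     else if S \<subseteq> {1..m} then x' i S else 0)"

definition tentative :: "nat \<Rightarrow> nat \<Rightarrow> (nat \<Rightarrow> nat set \<Rightarrow> real) \<Rightarrow> (nat \<Rightarrow> nat set) pmf" where
  "tentative n m x' = Pi_pmf {1..n} {} (tentative_bin m x')"

definition resolves ::
  "nat \<Rightarrow> (nat \<Rightarrow> nat \<Rightarrow> real) \<Rightarrow> (nat \<Rightarrow> nat set) \<Rightarrow> (nat \<Rightarrow> nat set) \<Rightarrow> bool" where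
  "resolves n v T S \<longleftrightarrow>
     (\<forall>i\<in>{1..n}. S i \<subseteq> T i) \<and>
     (\<forall>j\<in>(\<Union>i\<in>{1..n}. T i). \<exists>!i. i \<in> {1..n} \<and> j \<in> S i) \<and>
     (\<forall>i\<in>{1..n}. \<forall>j\<in>S i. \<forall>k\<in>{1..n}. j \<in> T k \<longrightarrow> v k j \<le> v i j)"

text \<open>
  The set of all output distributions of greedy rounding, over all runs of the first step and all
  ways of breaking ties.  The kernel \<open>K\<close> is the tie-breaking rule, which may be randomized.
\<close>

definition greedy_rounding ::
  "nat \<Rightarrow> nat \<Rightarrow> (nat \<Rightarrow> nat \<Rightarrow> real) \<Rightarrow> (nat \<Rightarrow> nat set \<Rightarrow> real) \<Rightarrow> (nat \<Rightarrow> nat set) pmf set" where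
  "greedy_rounding n m v x = {bind_pmf (tentative n m x') K | x' K.
     reduced_point n m x x' \<and>
     (\<forall>T\<in>set_pmf (tentative n m x'). \<forall>S\<in>set_pmf (K T). resolves n v T S)}"

text \<open>The relational definition of greedy rounding is not vacuous: the procedure never gets stuck.\<close>

lemma phi_remove_item:
  assumes "S \<subseteq> {1..m}" "j \<in> S"
  shows "phi m (remove_item i j S t x) i' j' = phi m x i' j' - (if i' = i \<and> j' = j then t else 0)"
proof -
  let ?A = "{S. S \<subseteq> {1..m} \<and> j' \<in> S}"
  have fin: "finite ?A" by (rule finite_subset[of _ "Pow {1..m}"]) auto
  have "phi m (remove_item i j S t x) i' j' = phi m x i' j'
      - (\<Sum>S'\<in>?A. if S' = S then (if i' = i then t else 0) else 0)
      + (\<Sum>S'\<in>?A. if S' = S - {j} then (if i' = i \<and> S - {j} \<noteq> {} then t else 0) else 0)"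
    unfolding phi_def remove_item_def sum_subtractf[symmetric] sum.distrib[symmetric]
    by (rule sum.cong) auto
  also have "\<dots> = phi m x i' j' - (if i' = i \<and> j' = j then t else 0)"
    using assms fin by auto
  finally show ?thesis .
qed

lemma reduce_pair_total:
  assumes "\<forall>i\<in>I. \<forall>j. \<delta> i j \<le> phi m x i j"
    and "i \<in> I"
  shows "\<exists>x' \<delta>'. reduce_pair m i j (x, \<delta>) (x', \<delta>') \<and> (\<forall>i\<in>I. \<forall>j. \<delta>' i j \<le> phi m x' i j)"
  using assms(1)
proof (induction "card {S. S \<subseteq> {1..m} \<and> j \<in> S \<and> x i S > 0}" arbitrary: x \<delta> rule: less_induct)
  case less
  show ?case
  proof (cases "\<delta> i j > 0")
    case False
    then show ?thesis using less.prems reduce_pair.stop[of \<delta> i j m x] by blast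
  next
    case True
    have "phi m x i j > 0" using True less.prems assms(2) order_less_le_trans by blast
    then obtain S where S: "S \<subseteq> {1..m}" "j \<in> S" "x i S > 0"
      unfolding phi_def by (metis (mono_tags, lifting) mem_Collect_eq not_less sum_nonpos)
    define t where "t = min (x i S) (\<delta> i j)"
    let ?x = "remove_item i j S t x" and ?\<delta> = "decrease i j t \<delta>"
    have le: "\<forall>i\<in>I. \<forall>j. ?\<delta> i j \<le> phi m ?x i j"
      using less.prems S by (simp add: phi_remove_item decrease_def)
    have "\<exists>x' \<delta>'. reduce_pair m i j (?x, ?\<delta>) (x', \<delta>') \<and> (\<forall>i\<in>I. \<forall>j. \<delta>' i j \<le> phi m x' i j)"
    proof (cases "?\<delta> i j > 0")
      case False
      then show ?thesis using le reduce_pair.stop[of ?\<delta> i j m ?x] by blast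
    next
      case pos: True
      then have t: "t = x i S" by (auto simp: decrease_def t_def)
      have sub: "{S. S \<subseteq> {1..m} \<and> j \<in> S \<and> ?x i S > 0} \<subset> {S. S \<subseteq> {1..m} \<and> j \<in> S \<and> x i S > 0}"
      proof (rule psubsetI)
        show "{S. S \<subseteq> {1..m} \<and> j \<in> S \<and> ?x i S > 0} \<subseteq> {S. S \<subseteq> {1..m} \<and> j \<in> S \<and> x i S > 0}"
          using S by (auto simp: remove_item_def t split: if_splits)
        have "?x i S = 0" using S by (auto simp: remove_item_def t)
        then show "{S. S \<subseteq> {1..m} \<and> j \<in> S \<and> ?x i S > 0} \<noteq> {S. S \<subseteq> {1..m} \<and> j \<in> S \<and> x i S > 0}"
          using S by (metis (mono_tags, lifting) less_irrefl mem_Collect_eq)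
      qed
      show ?thesis
        by (rule less.hyps[OF psubset_card_mono[OF _ sub] le])
           (rule finite_subset[of _ "Pow {1..m}"]; auto)
    qed
    then show ?thesis using reduce_pair.iterate[of \<delta> i j S m x, OF True S t_def] by blast
  qed
qed

lemma reduce_pairs_total:
  assumes "\<forall>i\<in>I. \<forall>j. \<delta> i j \<le> phi m x i j"
    and "fst ` set ps \<subseteq> I"
  shows "\<exists>x' \<delta>'. reduce_pairs m ps (x, \<delta>) (x', \<delta>')"
  using assms
proof (induction ps arbitrary: x \<delta>)
  case Nil
  then show ?case using reduce_pairs.Nil by blast
next
  case (Cons p ps)
  obtain i j where p: "p = (i, j)" by (cases p)
  have "i \<in> I" using Cons.prems(2) p by simp
  from reduce_pair_total[OF Cons.prems(1) this, of j] obtain x1 \<delta>1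
    where 1: "reduce_pair m i j (x, \<delta>) (x1, \<delta>1)" and 2: "\<forall>i\<in>I. \<forall>j. \<delta>1 i j \<le> phi m x1 i j" by blast
  have "fst ` set ps \<subseteq> I" using Cons.prems(2) by simp
  from Cons.IH[OF 2 this] obtain x' \<delta>' where "reduce_pairs m ps (x1, \<delta>1) (x', \<delta>')" by blast
  from reduce_pairs.Cons[OF 1 this] show ?case using p by blast
qed

lemma reduced_point_exists:
  assumes "x \<in> polytope_R n m w C"
  shows "\<exists>x'. reduced_point n m x x'"
proof -
  obtain ps where ps: "distinct ps" "set ps = {1..n} \<times> {1..m}"
    using finite_distinct_list[of "{1..n} \<times> {1..m}"] by auto
  have nonneg: "phi m x i j \<ge> 0" if "i \<in> {1..n}" for i j
    unfolding phi_def using assms that by (intro sum_nonneg) (auto simp: polytope_R_def)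
  have le: "\<forall>i\<in>{1..n}. \<forall>j. phi m x i j - (1 - exp (- phi m x i j)) \<le> phi m x i j"
    using nonneg by simp
  have "fst ` set ps \<subseteq> {1..n}" using ps(2) by auto
  from reduce_pairs_total[OF le this] ps show ?thesis unfolding reduced_point_def by blast
qed

lemma resolves_exists: "\<exists>S. resolves n v T S"
proof -
  define B where "B j = {i \<in> {1..n}. j \<in> T i}" for j
  have "\<exists>i. j \<in> (\<Union>i\<in>{1..n}. T i) \<longrightarrow> i \<in> B j \<and> (\<forall>k\<in>B j. v k j \<le> v i j)" for j
  proof (cases "B j = {}")
    case True
    then show ?thesis by (auto simp: B_def)
  next
    case False
    have fin: "finite (B j)" by (simp add: B_def)
    have "Max ((\<lambda>i. v i j) ` B j) \<in> (\<lambda>i. v i j) ` B j" using False fin by (intro Max_in) auto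
    then obtain i where "i \<in> B j" "v i j = Max ((\<lambda>i. v i j) ` B j)" by auto
    then show ?thesis using fin by (intro exI[of _ i]) auto
  qed
  then obtain b where b: "\<And>j. j \<in> (\<Union>i\<in>{1..n}. T i) \<Longrightarrow> b j \<in> B j \<and> (\<forall>k\<in>B j. v k j \<le> v (b j) j)"
    by metis
  have "resolves n v T (\<lambda>i. {j \<in> T i. b j = i})"
    unfolding resolves_def
  proof (intro conjI ballI)
    fix j assume "j \<in> (\<Union>i\<in>{1..n}. T i)"
    from b[OF this] show "\<exists>!i. i \<in> {1..n} \<and> j \<in> {j \<in> T i. b j = i}" by (auto simp: B_def)
  next
    fix i j k assume *: "i \<in> {1..n}" "j \<in> {j \<in> T i. b j = i}" "k \<in> {1..n}"
    then have "\<forall>k\<in>B j. v k j \<le> v i j" using b[of j] by blast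
    with * show "j \<in> T k \<longrightarrow> v k j \<le> v i j" by (simp add: B_def)
  qed auto
  then show ?thesis by blast
qed

lemma greedy_rounding_nonempty:
  assumes "x \<in> polytope_R n m w C"
  shows "greedy_rounding n m v x \<noteq> {}"
proof -
  obtain x' where x': "reduced_point n m x x'" using reduced_point_exists[OF assms] by blast
  obtain f where "\<And>T. resolves n v T (f T)" using resolves_exists by metis
  then have "bind_pmf (tentative n m x') (\<lambda>T. return_pmf (f T)) \<in> greedy_rounding n m v x"
    using x' unfolding greedy_rounding_def by fastforce
  then show ?thesis by blast
qed

end

theory Submission
  imports Defs
begin

text \<open>
  Moving mass from \<open>S\<close> to \<open>S - {j}\<close> keeps \<open>x\<close> in the polytope and \<open>phi m x - \<delta>\<close> constant, and a terminating
  run ends with \<open>\<delta> = 0\<close>.  So bin \<open>i\<close> tentatively receives item \<open>j\<close> with probability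
  \<open>1 - exp (- phi m x i j)\<close>, independently of the other bins.  Whatever the tie-breaking, item \<open>j\<close>
  contributes the largest value among the bins that tentatively hold it.  Telescoping along \<open>\<sigma> j\<close>
  turns this maximum into a combination of indicators of the events that one of the first \<open>i\<close> bins
  holds \<open>j\<close>, and by independence such an event has probability
  \<open>1 - exp (- (\<Sum>k=1..i. phi m x (\<sigma> j k) j))\<close>.
\<close>

section \<open>Feasible sets, the polytope and moves of mass\<close>

lemma finite_feasible [simp]: "finite (feasible m w C i)"
  by (rule finite_subset[of _ "Pow {1..m}"]) (auto simp: feasible_def)

lemma feasible_mono:
  assumes "T \<in> feasible m w C i" "S \<subseteq> T" "\<And>j. j \<in> {1..m} \<Longrightarrow> w i j \<ge> 0"
  shows "S \<in> feasible m w C i"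
proof -
  have "T \<subseteq> {1..m}" using assms(1) by (simp add: feasible_def)
  then have "(\<Sum>j\<in>S. w i j) \<le> (\<Sum>j\<in>T. w i j)"
    using assms(2,3) by (intro sum_mono2) (auto intro: finite_subset)
  then show ?thesis using assms(1,2) by (auto simp: feasible_def)
qed

text \<open>A feasible coordinate is bounded by the row sum, hence by 1, and an infeasible one is 0.
  After a move of mass only signs, support and row sums remain to be checked.\<close>

lemma polytope_R_iff:
  "x \<in> polytope_R n m w C \<longleftrightarrow> (\<forall>i\<in>{1..n}.
     (\<forall>S\<in>Pow {1..m}. 0 \<le> x i S) \<and>
     (\<forall>S\<in>Pow {1..m}. S \<notin> feasible m w C i \<longrightarrow> x i S = 0) \<and>
     (\<Sum>S\<in>feasible m w C i. x i S) \<le> 1)"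
  (is "_ \<longleftrightarrow> ?R")
proof
  show "x \<in> polytope_R n m w C \<Longrightarrow> ?R" by (auto simp: polytope_R_def)
next
  assume R: ?R
  have "x i S \<le> 1" if "i \<in> {1..n}" "S \<in> Pow {1..m}" for i S
  proof (cases "S \<in> feasible m w C i")
    case True
    have "x i S \<le> (\<Sum>S\<in>feasible m w C i. x i S)"
      using R that True by (intro member_le_sum) (auto simp: feasible_def)
    also have "\<dots> \<le> 1" using R that by auto
    finally show ?thesis .
  qed (use R that in auto)
  then show "x \<in> polytope_R n m w C" using R by (auto simp: polytope_R_def)
qed

text \<open>Positive mass forces \<open>S\<close> to be feasible, and nonnegative weights make
  \<open>S - {j}\<close> feasible too. The row sum is unchanged, or falls by \<open>t\<close> when
  \<open>S - {j}\<close> is empty and the mass is discarded.\<close>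

lemma remove_item_in_polytope_R:
  assumes w: "\<And>i j. i \<in> {1..n} \<Longrightarrow> j \<in> {1..m} \<Longrightarrow> w i j \<ge> 0"
    and x: "x \<in> polytope_R n m w C"
    and i: "i \<in> {1..n}" and S: "S \<subseteq> {1..m}" and t: "0 < t" "t \<le> x i S"
  shows "remove_item i j S t x \<in> polytope_R n m w C"
proof -
  let ?x = "remove_item i j S t x"
  have feas: "S \<in> feasible m w C i"
    using x i S t unfolding polytope_R_iff by force
  then have feas': "S - {j} \<in> feasible m w C i"
    by (rule feasible_mono) (use w i in auto)
  have nonneg: "0 \<le> ?x i' S'" if "i' \<in> {1..n}" "S' \<in> Pow {1..m}" for i' S'
    using x that t by (auto simp: remove_item_def polytope_R_iff)
  have zero: "?x i' S' = 0"
    if "i' \<in> {1..n}" "S' \<in> Pow {1..m}" "S' \<notin> feasible m w C i'" for i' S'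
    using x that feas feas' unfolding polytope_R_iff remove_item_def by auto
  have "(\<Sum>S'\<in>feasible m w C i'. ?x i' S') \<le> 1" if i': "i' \<in> {1..n}" for i'
  proof -
    have "(\<Sum>S'\<in>feasible m w C i'. ?x i' S') = (\<Sum>S'\<in>feasible m w C i'. x i' S')
        - (\<Sum>S'\<in>feasible m w C i'. if S' = S then (if i' = i then t else 0) else 0)
        + (\<Sum>S'\<in>feasible m w C i'.
            if S' = S - {j} then (if i' = i \<and> S - {j} \<noteq> {} then t else 0) else 0)"
      unfolding remove_item_def sum_subtractf[symmetric] sum.distrib[symmetric]
      by (rule sum.cong) auto
    also have "\<dots> \<le> (\<Sum>S'\<in>feasible m w C i'. x i' S')"
      using feas feas' t by auto
    also have "\<dots> \<le> 1" using x i' by (auto simp: polytope_R_iff)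
    finally show ?thesis .
  qed
  then show ?thesis unfolding polytope_R_iff using nonneg zero by blast
qed

section \<open>Invariants of the reduction procedure\<close>

lemma reduce_pair_in_polytope_R:
  assumes "reduce_pair m i j s s'"
    and "\<And>i j. i \<in> {1..n} \<Longrightarrow> j \<in> {1..m} \<Longrightarrow> w i j \<ge> 0"
    and "i \<in> {1..n}" "fst s \<in> polytope_R n m w C"
  shows "fst s' \<in> polytope_R n m w C"
  using assms(1,4)
proof (induction rule: reduce_pair.induct)
  case (iterate \<delta> S x t s)
  have "remove_item i j S t x \<in> polytope_R n m w C"
    by (rule remove_item_in_polytope_R) (use iterate assms(2,3) in auto)
  then show ?case using iterate.IH by simp
qed simp

text \<open>As \<open>j \<in> S\<close>, a move lowers \<open>phi\<close> by \<open>t\<close> at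
  \<open>(i, j)\<close> only: every other item of \<open>S\<close> stays in \<open>S - {j}\<close>.
  The entry of \<open>\<delta>\<close> falls by the same \<open>t\<close>.\<close>

lemma reduce_pair_phi:
  assumes "reduce_pair m i j s s'"
  shows "phi m (fst s') i' j' - snd s' i' j' = phi m (fst s) i' j' - snd s i' j'"
  using assms by induction (simp_all add: phi_remove_item decrease_def)

text \<open>Since \<open>t \<le> \<delta> i j\<close>, the entry never becomes negative; a run can
  only end where it is not positive, so it ends at 0.\<close>

lemma reduce_pair_delta:
  assumes "reduce_pair m i j s s'" "snd s i j \<ge> 0"
  shows "snd s' i' j' = (if i' = i \<and> j' = j then 0 else snd s i' j')"
  using assms by induction (auto simp: decrease_def)

lemma reduce_pairs_in_polytope_R:
  assumes "reduce_pairs m ps s s'"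
    and "\<And>i j. i \<in> {1..n} \<Longrightarrow> j \<in> {1..m} \<Longrightarrow> w i j \<ge> 0"
    and "fst ` set ps \<subseteq> {1..n}" "fst s \<in> polytope_R n m w C"
  shows "fst s' \<in> polytope_R n m w C"
  using assms(1,3,4)
proof (induction rule: reduce_pairs.induct)
  case (Cons i j s s1 ps s2)
  have "fst s1 \<in> polytope_R n m w C"
    by (rule reduce_pair_in_polytope_R[OF Cons.hyps(1)]) (use Cons.prems assms(2) in auto)
  then show ?case using Cons by simp
qed simp

lemma reduce_pairs_phi:
  assumes "reduce_pairs m ps s s'"
  shows "phi m (fst s') i j - snd s' i j = phi m (fst s) i j - snd s i j"
  using assms by induction (simp_all add: reduce_pair_phi)

lemma reduce_pairs_delta:
  assumes "reduce_pairs m ps s s'" "\<And>i j. (i, j) \<in> set ps \<Longrightarrow> snd s i j \<ge> 0"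
  shows "snd s' i j = (if (i, j) \<in> set ps then 0 else snd s i j)"
  using assms
proof (induction rule: reduce_pairs.induct)
  case (Cons a b s s1 ps s2)
  \<comment> \<open>Stated for all pairs, because the induction hypothesis needs every remaining
    entry to be nonnegative: each is either 0 or unchanged.\<close>
  have s1: "snd s1 i j = (if i = a \<and> j = b then 0 else snd s i j)" for i j
    by (rule reduce_pair_delta[OF Cons.hyps(1)]) (use Cons.prems in simp)
  have "snd s2 i j = (if (i, j) \<in> set ps then 0 else snd s1 i j)"
    using Cons.prems by (intro Cons.IH) (auto simp: s1)
  then show ?case using s1 by auto
qed simp

lemma reduced_point_in_polytope_R:
  assumes "reduced_point n m x x'" "x \<in> polytope_R n m w C"
    and "\<And>i j. i \<in> {1..n} \<Longrightarrow> j \<in> {1..m} \<Longrightarrow> w i j \<ge> 0"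
  shows "x' \<in> polytope_R n m w C"
proof -
  obtain ps \<delta>' where ps: "set ps = {1..n} \<times> {1..m}"
    and red: "reduce_pairs m ps (x, \<lambda>i j. phi m x i j - (1 - exp (- phi m x i j))) (x', \<delta>')"
    using assms(1) by (auto simp: reduced_point_def)
  show ?thesis
    using reduce_pairs_in_polytope_R[OF red, of n w C] assms(3) ps assms(2) by auto
qed

lemma phi_reduced_point:
  assumes "reduced_point n m x x'" "i \<in> {1..n}" "j \<in> {1..m}"
  shows "phi m x' i j = 1 - exp (- phi m x i j)"
proof -
  let ?\<delta> = "\<lambda>i j. phi m x i j - (1 - exp (- phi m x i j))"
  obtain ps \<delta>' where ps: "set ps = {1..n} \<times> {1..m}"
    and red: "reduce_pairs m ps (x, ?\<delta>) (x', \<delta>')"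
    using assms(1) by (auto simp: reduced_point_def)
  \<comment> \<open>This is \<open>1 + z \<le> exp z\<close> at
    \<open>z = - phi m x i j\<close>.\<close>
  have "?\<delta> i j \<ge> 0" for i j
    using exp_ge_add_one_self[of "- phi m x i j"] by simp
  then have "\<delta>' i j = 0"
    using reduce_pairs_delta[OF red, of i j] assms(2,3) ps by simp
  then show ?thesis using reduce_pairs_phi[OF red, of i j] by simp
qed

section \<open>The tentative assignment and its probabilities\<close>

text \<open>Discharges the side conditions of \<open>embed_pmf\<close>: the polytope constraints
  make the weights nonnegative, and the weight of the empty set completes the total to 1.\<close>

lemma pmf_tentative_bin:
  assumes x: "x \<in> polytope_R n m w C" and i: "i \<in> {1..n}"
  shows "pmf (tentative_bin m x i) S =
    (if S = {} then 1 - (\<Sum>S'\<in>Pow {1..m} - {{}}. x i S')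
     else if S \<subseteq> {1..m} then x i S else 0)"
  unfolding tentative_bin_def
proof (rule pmf_embed_pmf)
  let ?f = "\<lambda>S. if S = {} then 1 - (\<Sum>S'\<in>Pow {1..m} - {{}}. x i S')
     else if S \<subseteq> {1..m} then x i S else 0"
  have nonneg: "0 \<le> x i S" if "S \<in> Pow {1..m}" for S
    using x i that by (auto simp: polytope_R_iff)
  \<comment> \<open>Infeasible sets carry no mass, so the row bound of the polytope applies; it
    makes the weight of the empty set nonnegative.\<close>
  have "(\<Sum>S\<in>Pow {1..m} - {{}}. x i S) = (\<Sum>S\<in>feasible m w C i - {{}}. x i S)"
    using x i by (intro sum.mono_neutral_right) (auto simp: feasible_def polytope_R_iff)
  also have "\<dots> \<le> (\<Sum>S\<in>feasible m w C i. x i S)"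
    using nonneg by (intro sum_mono2) (auto simp: feasible_def)
  also have "\<dots> \<le> 1" using x i by (auto simp: polytope_R_iff)
  finally have le: "(\<Sum>S\<in>Pow {1..m} - {{}}. x i S) \<le> 1" .
  show f: "0 \<le> ?f S" for S using le nonneg by auto
  have "(\<Sum>S\<in>Pow {1..m}. ?f S) = ?f {} + (\<Sum>S\<in>Pow {1..m} - {{}}. ?f S)"
    by (rule sum.remove) auto
  also have "(\<Sum>S\<in>Pow {1..m} - {{}}. ?f S) = (\<Sum>S\<in>Pow {1..m} - {{}}. x i S)"
    by (rule sum.cong) auto
  finally have sum1: "(\<Sum>S\<in>Pow {1..m}. ?f S) = 1" by simp
  have "(\<integral>\<^sup>+ S. ennreal (?f S) \<partial>count_space UNIV) = (\<Sum>S\<in>Pow {1..m}. ennreal (?f S))"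
    by (rule nn_integral_count_space') (auto split: if_splits)
  also have "\<dots> = ennreal (\<Sum>S\<in>Pow {1..m}. ?f S)"
    using f by (rule sum_ennreal)
  finally show "(\<integral>\<^sup>+ S. ennreal (?f S) \<partial>count_space UNIV) = 1"
    by (simp only: sum1 ennreal_1)
qed

text \<open>The empty set can receive leftover probability whatever \<open>x i {}\<close> is; it is
  feasible because \<open>C i \<ge> 0\<close>.\<close>

lemma set_pmf_tentative_bin:
  assumes "x \<in> polytope_R n m w C" "i \<in> {1..n}" "C i \<ge> 0"
  shows "set_pmf (tentative_bin m x i) \<subseteq> feasible m w C i"
proof
  fix S assume "S \<in> set_pmf (tentative_bin m x i)"
  then have "pmf (tentative_bin m x i) S \<noteq> 0" by (simp add: set_pmf_iff)
  then have "S = {} \<or> S \<subseteq> {1..m} \<and> x i S \<noteq> 0"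
    unfolding pmf_tentative_bin[OF assms(1,2)] by (auto split: if_splits)
  then show "S \<in> feasible m w C i"
    using assms unfolding polytope_R_iff by (auto simp: feasible_def)
qed

text \<open>No set containing \<open>j\<close> is empty, so the leftover probability does not enter,
  and the weights summed are exactly those in \<open>phi\<close>.\<close>

lemma prob_tentative_bin_mem:
  assumes "x \<in> polytope_R n m w C" "i \<in> {1..n}"
  shows "measure_pmf.prob (tentative_bin m x i) {S. j \<in> S} = phi m x i j"
proof -
  let ?A = "{S. S \<subseteq> {1..m} \<and> j \<in> S}"
  have fin: "finite ?A" by (rule finite_subset[of _ "Pow {1..m}"]) auto
  have supp: "S \<subseteq> {1..m}" if "S \<in> set_pmf (tentative_bin m x i)" for S
    using that pmf_tentative_bin[OF assms, of S] by (auto simp: set_pmf_iff split: if_splits)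
  have "measure_pmf.prob (tentative_bin m x i) {S. j \<in> S} = measure_pmf.prob (tentative_bin m x i) ?A"
    using supp by (intro measure_prob_cong_0) (auto simp: set_pmf_iff)
  also have "\<dots> = (\<Sum>S\<in>?A. pmf (tentative_bin m x i) S)"
    by (rule measure_measure_pmf_finite[OF fin])
  also have "\<dots> = phi m x i j"
    unfolding phi_def by (rule sum.cong) (auto simp: pmf_tentative_bin[OF assms])
  finally show ?thesis .
qed

text \<open>The complement, that no bin of \<open>B\<close> holds \<open>j\<close>, is a product
  event, so independence turns its probability into a product.\<close>

lemma prob_tentative_mem_Union:
  assumes "x \<in> polytope_R n m w C" "B \<subseteq> {1..n}"
  shows "measure_pmf.prob (tentative n m x) {T. \<exists>i\<in>B. j \<in> T i} = 1 - (\<Prod>i\<in>B. 1 - phi m x i j)"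
proof -
  \<comment> \<open>Bins outside \<open>B\<close> are unconstrained and contribute a factor 1, which
    extends the product from \<open>B\<close> to all bins.\<close>
  let ?E = "\<lambda>i. if i \<in> B then {S. j \<notin> S} else UNIV"
  have compl: "{T. \<exists>i\<in>B. j \<in> T i} = UNIV - Pi {1..n} ?E"
    using assms(2) by (auto simp: Pi_def)
  have "measure_pmf.prob (tentative_bin m x i) {S. j \<notin> S} = 1 - phi m x i j" if "i \<in> B" for i
  proof -
    have "i \<in> {1..n}" using that assms(2) by auto
    moreover have "{S. j \<notin> S} = UNIV - {S. j \<in> S}" by auto
    ultimately show ?thesis
      using measure_pmf.prob_compl[of "{S. j \<in> S}" "tentative_bin m x i"]
        prob_tentative_bin_mem[OF assms(1), of i j] by simp
  qed
  then have "(\<Prod>i\<in>B. 1 - phi m x i j) = (\<Prod>i\<in>B. measure_pmf.prob (tentative_bin m x i) (?E i))"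
    by (intro prod.cong) auto
  also have "\<dots> = (\<Prod>i\<in>{1..n}. measure_pmf.prob (tentative_bin m x i) (?E i))"
    using assms(2) by (intro prod.mono_neutral_left) auto
  also have "\<dots> = measure_pmf.prob (tentative n m x) (Pi {1..n} ?E)"
    unfolding tentative_def by (rule measure_Pi_pmf_Pi[symmetric]) simp
  finally show ?thesis
    unfolding compl using measure_pmf.prob_compl[of "Pi {1..n} ?E" "tentative n m x"] by simp
qed

section \<open>Value of a resolved assignment\<close>

text \<open>Both sides equal \<open>v (\<sigma> j k) j\<close>, where \<open>k\<close> is the first
  position in the order \<open>\<sigma> j\<close> whose bin tentatively holds \<open>j\<close>; if
  there is none, both are 0.\<close>

lemma sum_resolves_item:
  assumes order: "value_order n m v \<sigma>" and j: "j \<in> {1..m}" and res: "resolves n v T S"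
  shows "(\<Sum>i=1..n. if j \<in> S i then v i j else 0) =
    (\<Sum>i=1..n. (sorted_value n v \<sigma> j i - sorted_value n v \<sigma> j (i + 1)) *
       indicat_real {T. \<exists>i\<in>\<sigma> j ` {1..i}. j \<in> T i} T)"
proof -
  have perm: "\<sigma> j permutes {1..n}" using order j by (auto simp: value_order_def)
  let ?P = "\<lambda>k. k \<in> {1..n} \<and> j \<in> T (\<sigma> j k)"
  show ?thesis
  proof (cases "\<exists>k. ?P k")
    case False
    have "j \<notin> T i" if "i \<in> {1..n}" for i
      using False that permutes_image[OF perm] by (metis imageE)
    then have "j \<notin> S i" if "i \<in> {1..n}" for i
      using that res unfolding resolves_def by blast
    then show ?thesis using False by (auto intro!: sum.neutral)
  next
    case True
    define k where "k = (LEAST k. ?P k)"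
    have k: "?P k" unfolding k_def using True by (rule LeastI_ex)
    have least: "k \<le> l" if "?P l" for l unfolding k_def using that by (rule Least_le)
    have sk: "\<sigma> j k \<in> {1..n}" using k permutes_in_image[OF perm] by blast
    have "\<exists>!i. i \<in> {1..n} \<and> j \<in> S i"
      using res k sk unfolding resolves_def by blast
    then obtain i where i: "i \<in> {1..n}" "j \<in> S i"
      and uniq: "\<And>i'. i' \<in> {1..n} \<Longrightarrow> j \<in> S i' \<Longrightarrow> i' = i" by blast
    \<comment> \<open>Under ties the keeper \<open>i\<close> may differ from
      \<open>\<sigma> j k\<close>, so only the values are compared: the order gives one inequality
      as \<open>k \<le> l\<close>, the rule for keeping \<open>j\<close> gives the other.\<close>
    have "i \<in> \<sigma> j ` {1..n}" using i(1) permutes_image[OF perm] by simp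
    then obtain l where l: "l \<in> {1..n}" "i = \<sigma> j l" by blast
    have "j \<in> T i" using res i by (auto simp: resolves_def)
    then have "k \<le> l" using least l by simp
    then have "v i j \<le> v (\<sigma> j k) j"
      using order j k l by (auto simp: value_order_def)
    moreover have "v (\<sigma> j k) j \<le> v i j"
      using res i k sk by (auto simp: resolves_def)
    ultimately have vi: "v i j = v (\<sigma> j k) j" by simp
    have "j \<in> S i' \<longleftrightarrow> i' = i" if "i' \<in> {1..n}" for i'
      using i(2) uniq[OF that] by blast
    then have "(\<Sum>i'=1..n. if j \<in> S i' then v i' j else 0) = (\<Sum>i'=1..n. if i' = i then v i j else 0)"
      by (intro sum.cong) simp_all
    also have "\<dots> = v (\<sigma> j k) j" using i vi by simp
    finally have lhs: "(\<Sum>i'=1..n. if j \<in> S i' then v i' j else 0) = v (\<sigma> j k) j" .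
    \<comment> \<open>By minimality of \<open>k\<close>, one of the first \<open>i\<close> bins in
      the order holds \<open>j\<close> exactly when \<open>k \<le> i\<close>.\<close>
    have ind: "indicat_real {T. \<exists>l\<in>\<sigma> j ` {1..i}. j \<in> T l} T = (if k \<le> i then 1 else 0)"
      if "i \<in> {1..n}" for i
    proof -
      have "k \<le> i" if "l \<in> {1..i}" "j \<in> T (\<sigma> j l)" for l
        using least[of l] that \<open>i \<in> {1..n}\<close> by simp
      then have "(\<exists>l\<in>\<sigma> j ` {1..i}. j \<in> T l) \<longleftrightarrow> k \<le> i"
        using k by auto
      then show ?thesis by (simp add: indicator_def)
    qed
    have "(\<Sum>i=1..n. (sorted_value n v \<sigma> j i - sorted_value n v \<sigma> j (i + 1)) *
       indicat_real {T. \<exists>i\<in>\<sigma> j ` {1..i}. j \<in> T i} T)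
      = (\<Sum>i=1..n. if k \<le> i then sorted_value n v \<sigma> j i - sorted_value n v \<sigma> j (i + 1) else 0)"
      by (intro sum.cong refl) (subst ind; simp)
    also have "\<dots> = (\<Sum>i=k..n. sorted_value n v \<sigma> j i - sorted_value n v \<sigma> j (i + 1))"
      using k by (intro sum.mono_neutral_cong_right) auto
    also have "\<dots> = - (\<Sum>i=k..n. sorted_value n v \<sigma> j (Suc i) - sorted_value n v \<sigma> j i)"
      by (simp only: sum_negf[symmetric] minus_diff_eq Suc_eq_plus1)
    \<comment> \<open>The telescoped sum ends at position \<open>n + 1\<close>, where
      \<open>sorted_value\<close> is 0 by convention; at \<open>k \<le> n\<close> it is the actual
      value.\<close>
    also have "\<dots> = v (\<sigma> j k) j"
      using k by (subst sum_Suc_diff) (auto simp: sorted_value_def)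
    finally show ?thesis using lhs by simp
  qed
qed

text \<open>Each \<open>S i\<close> is a subset of the feasible set \<open>T i\<close>, so
  \<open>bin_value\<close> never falls back to 0 and is additive over items. Exchanging the sums
  reduces the claim to one item at a time.\<close>

lemma sum_bin_value_resolves:
  assumes w: "\<And>i j. i \<in> {1..n} \<Longrightarrow> j \<in> {1..m} \<Longrightarrow> w i j \<ge> 0"
    and order: "value_order n m v \<sigma>" and res: "resolves n v T S"
    and T: "\<And>i. i \<in> {1..n} \<Longrightarrow> T i \<in> feasible m w C i"
  shows "(\<Sum>i=1..n. bin_value m v w C i (S i)) =
    (\<Sum>j=1..m. \<Sum>i=1..n. (sorted_value n v \<sigma> j i - sorted_value n v \<sigma> j (i + 1)) *
       indicat_real {T. \<exists>i\<in>\<sigma> j ` {1..i}. j \<in> T i} T)"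
proof -
  have "bin_value m v w C i (S i) = (\<Sum>j=1..m. if j \<in> S i then v i j else 0)"
    if i: "i \<in> {1..n}" for i
  proof -
    have "S i \<subseteq> T i" using res i by (auto simp: resolves_def)
    then have feas: "S i \<in> feasible m w C i"
      using feasible_mono[OF T[OF i]] w i by blast
    then have "{1..m} \<inter> S i = S i" by (auto simp: feasible_def)
    then show ?thesis
      using feas by (simp add: bin_value_def sum.If_cases)
  qed
  then have "(\<Sum>i=1..n. bin_value m v w C i (S i)) =
      (\<Sum>i=1..n. \<Sum>j=1..m. if j \<in> S i then v i j else 0)" by simp
  also have "\<dots> = (\<Sum>j=1..m. \<Sum>i=1..n. if j \<in> S i then v i j else 0)"
    by (rule sum.swap)
  also have "\<dots> = (\<Sum>j=1..m. \<Sum>i=1..n.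
      (sorted_value n v \<sigma> j i - sorted_value n v \<sigma> j (i + 1)) *
       indicat_real {T. \<exists>i\<in>\<sigma> j ` {1..i}. j \<in> T i} T)"
    by (rule sum.cong) (use sum_resolves_item[OF order _ res] in auto)
  finally show ?thesis .
qed

section \<open>Expectations over the rounding\<close>

lemma expectation_sum_indicator:
  "measure_pmf.expectation M (\<lambda>T. \<Sum>j\<in>J. \<Sum>i\<in>I. c j i * indicat_real (E j i) T) =
    (\<Sum>j\<in>J. \<Sum>i\<in>I. c j i * measure_pmf.prob M (E j i))"
proof -
  have int: "integrable M (\<lambda>T. c j i * indicat_real (E j i) T)" for j i
    by (intro integrable_mult_right integrable_real_indicator) (auto simp: less_top[symmetric])
  have "measure_pmf.expectation M (\<lambda>T. \<Sum>j\<in>J. \<Sum>i\<in>I. c j i * indicat_real (E j i) T) =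
      (\<Sum>j\<in>J. \<Sum>i\<in>I. measure_pmf.expectation M (\<lambda>T. c j i * indicat_real (E j i) T))"
    by (subst Bochner_Integration.integral_sum; (intro Bochner_Integration.integrable_sum int)?)
       (intro sum.cong refl Bochner_Integration.integral_sum int)
  then show ?thesis by simp
qed

text \<open>Removes the tie-breaking kernel: \<open>f\<close> is constant on the support of each
  \<open>K T\<close>. Both integrals are over the same image distribution, so the equality also
  covers non-integrable functions.\<close>

lemma expectation_bind_pmf_const:
  fixes f :: "'a \<Rightarrow> 'b::{banach, second_countable_topology}"
  assumes "\<And>T S. T \<in> set_pmf M \<Longrightarrow> S \<in> set_pmf (K T) \<Longrightarrow> f S = g T"
  shows "measure_pmf.expectation (bind_pmf M K) f = measure_pmf.expectation M g"
proof -
  have "map_pmf f (K T) = return_pmf (g T)" if "T \<in> set_pmf M" for T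
  proof -
    have "map_pmf f (K T) = map_pmf (\<lambda>_. g T) (K T)"
      using assms that by (intro map_pmf_cong) auto
    then show ?thesis by simp
  qed
  then have "map_pmf f (bind_pmf M K) = map_pmf g M"
    unfolding map_bind_pmf by (simp add: map_pmf_def cong: bind_pmf_cong)
  then show ?thesis
    using integral_map_pmf[of f "bind_pmf M K" "\<lambda>x. x"] integral_map_pmf[of g M "\<lambda>x. x"]
    by simp
qed

theorem lemma3p2:
  fixes n m :: nat
    and v w :: "nat \<Rightarrow> nat \<Rightarrow> real"
    and C :: "nat \<Rightarrow> real"
    and \<sigma> :: "nat \<Rightarrow> nat \<Rightarrow> nat"
    and x :: "nat \<Rightarrow> nat set \<Rightarrow> real"
    and D :: "(nat \<Rightarrow> nat set) pmf"
  assumes "\<And>i j. i \<in> {1..n} \<Longrightarrow> j \<in> {1..m} \<Longrightarrow> v i j \<ge> 0"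
    and "\<And>i j. i \<in> {1..n} \<Longrightarrow> j \<in> {1..m} \<Longrightarrow> w i j \<ge> 0"
    and "\<And>i. i \<in> {1..n} \<Longrightarrow> C i \<ge> 0"
    and "value_order n m v \<sigma>"
    and "x \<in> polytope_R n m w C"
    and "D \<in> greedy_rounding n m v x"
  shows "measure_pmf.expectation D (\<lambda>S. \<Sum>i=1..n. bin_value m v w C i (S i))
           = F_obj n m v \<sigma> (phi m x)"
proof -
  obtain x' K where D: "D = bind_pmf (tentative n m x') K"
    and red: "reduced_point n m x x'"
    and res: "\<And>T S. T \<in> set_pmf (tentative n m x') \<Longrightarrow> S \<in> set_pmf (K T) \<Longrightarrow> resolves n v T S"
    using assms(6) by (auto simp: greedy_rounding_def)
  have x': "x' \<in> polytope_R n m w C"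
    using red assms(5,2) by (rule reduced_point_in_polytope_R)
  let ?E = "\<lambda>j i. {T. \<exists>l\<in>\<sigma> j ` {1..i}. j \<in> T l}"
  let ?d = "\<lambda>j i. sorted_value n v \<sigma> j i - sorted_value n v \<sigma> j (i + 1)"
  have T: "T i \<in> feasible m w C i" if "T \<in> set_pmf (tentative n m x')" "i \<in> {1..n}" for T i
    using that set_pmf_tentative_bin[OF x' that(2) assms(3)[OF that(2)]]
    by (auto simp: tentative_def set_Pi_pmf PiE_dflt_def)
  \<comment> \<open>The total value is determined by the tentative assignment alone, however ties
    are broken.\<close>
  have "measure_pmf.expectation D (\<lambda>S. \<Sum>i=1..n. bin_value m v w C i (S i)) =
      measure_pmf.expectation (tentative n m x')
        (\<lambda>T. \<Sum>j=1..m. \<Sum>i=1..n. ?d j i * indicat_real (?E j i) T)"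
    unfolding D using sum_bin_value_resolves[OF assms(2,4) res T]
    by (rule expectation_bind_pmf_const)
  also have "\<dots> = (\<Sum>j=1..m. \<Sum>i=1..n. ?d j i * measure_pmf.prob (tentative n m x') (?E j i))"
    by (rule expectation_sum_indicator)
  also have "\<dots> = F_obj n m v \<sigma> (phi m x)"
    unfolding F_obj_def
  proof (intro sum.cong refl arg_cong2[where f = "(*)"])
    fix j i assume j: "j \<in> {1..m}" and i: "i \<in> {1..n}"
    have perm: "\<sigma> j permutes {1..n}" using assms(4) j by (auto simp: value_order_def)
    have sub: "\<sigma> j ` {1..i} \<subseteq> {1..n}"
      using permutes_image[OF perm] i by fastforce
    have "measure_pmf.prob (tentative n m x') (?E j i) = 1 - (\<Prod>l\<in>\<sigma> j ` {1..i}. 1 - phi m x' l j)"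
      using x' sub by (rule prob_tentative_mem_Union)
    \<comment> \<open>The reduction to \<open>1 - exp (- phi m x l j)\<close> makes each
      complementary probability an exponential, so the product over bins becomes the exponential of
      a sum as in \<open>F_obj\<close>.\<close>
    also have "(\<Prod>l\<in>\<sigma> j ` {1..i}. 1 - phi m x' l j) = (\<Prod>l\<in>\<sigma> j ` {1..i}. exp (- phi m x l j))"
      by (rule prod.cong) (use phi_reduced_point[OF red _ j] sub in auto)
    also have "\<dots> = (\<Prod>k=1..i. exp (- phi m x (\<sigma> j k) j))"
      by (rule prod.reindex_cong[of "\<sigma> j"]) (use permutes_inj_on[OF perm] in auto)
    also have "\<dots> = exp (- (\<Sum>k=1..i. phi m x (\<sigma> j k) j))"
      by (simp add: exp_sum sum_negf[symmetric])
    finally show "measure_pmf.prob (tentative n m x') (?E j i) =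
        1 - exp (- (\<Sum>k=1..i. phi m x (\<sigma> j k) j))" .
  qed
  finally show ?thesis .
qed

end
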